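(* Let $p,q$ be distinct primes, let $G=C_{pq}$ be the cyclic group of order $pq$, and let $\mathcal{A}\in\mathcal{O}_G[\mathrm{DGA}]$. If $\mathcal{A}$ is injective as an object of $Vec^*_G$, then all the structure maps of $\mathcal{A}$ are surjective.
   Context: All DGAs are commutative differential graded algebras over $\mathbb{Q}$. Orbit category: for a finite group $G$, $\mathcal{O}_G$ is the category whose objects are the $G$-sets $G/H$ ($H\le G$) and whose morphisms are $G$-maps. $\mathcal{O}_G[\mathrm{DGA}]$ is the category of diagrams of DGAs, i.e. covariant functors from $\mathcal{O}_G$ to cohomologically $1$-connected DGAs ($H^0=\mathbb{Q}$, $H^1=0$). $Vec^*_G$ is the category of dual rational coefficient systems, i.e. covariant functors from $\mathcal{O}_G$ to graded $\mathbb{Q}$-vector spaces. A diagram of DGAs is regarded as an object of $Vec^*_G$ by forgetting differential and multiplication. An object $I$ of a category is injective if for every injective morphism $f:X\to Y$ (for $Vec^*_G$: injective at every $G/H$) and every morphism $g:X\to I$ there is $h:Y\to I$ with $h\circ f=g$. The structure maps of $\mathcal{A}$ are the maps $\mathcal{A}(G/H)\to\mathcal{A}(G/K)$ induced by the projections $G/H\to G/K$ for subgroups $H\subset K$ of $G$. *)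

theory Defs
  imports
    "HOL-Algebra.Algebraic_Closure_Type"
    "HOL-Algebra.Elementary_Groups"
    "HOL-Algebra.Left_Coset"
    "HOL-Algebra.Module"
    "HOL-Computational_Algebra.Primes"
begin

section \<open>The orbit category\<close>

text \<open>
  The object \<open>G/H\<close> is the set of left cosets of \<open>H\<close>, on which \<open>G\<close> acts by left translation.
\<close>

definition orbits :: "('g, 'm) monoid_scheme \<Rightarrow> 'g set set set" where
  "orbits G = {lcosets\<^bsub>G\<^esub> H | H. subgroup H G}"

definition orbit_maps ::
    "('g, 'm) monoid_scheme \<Rightarrow> 'g set set \<Rightarrow> 'g set set \<Rightarrow> ('g set \<Rightarrow> 'g set) set" where
  "orbit_maps G S T =
     {f \<in> S \<rightarrow>\<^sub>E T. \<forall>g \<in> carrier G. \<forall>x \<in> S. f (g <#\<^bsub>G\<^esub> x) = g <#\<^bsub>G\<^esub> f x}"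

text \<open>For \<open>H \<subseteq> K\<close> the product of subsets \<open>(gH)K\<close> is \<open>gK\<close>.\<close>

definition orbit_proj ::
    "('g, 'm) monoid_scheme \<Rightarrow> 'g set \<Rightarrow> 'g set \<Rightarrow> 'g set \<Rightarrow> 'g set" where
  "orbit_proj G H K = (\<lambda>x \<in> lcosets\<^bsub>G\<^esub> H. x <#>\<^bsub>G\<^esub> K)"


section \<open>Graded rational vector spaces\<close>

text \<open>
  Gradings are by the natural numbers. Of each record \<open>V n\<close> only the additive group and the
  scalar multiplication are used; its ring multiplication and one are irrelevant.
\<close>

abbreviation rat_field :: "rat ring" where
  "rat_field \<equiv> ring_of_type_algebra"

type_synonym 'u graded = "nat \<Rightarrow> (rat, 'u) module"

definition graded_space :: "'u graded \<Rightarrow> bool" where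
  "graded_space V \<longleftrightarrow> (\<forall>n. module rat_field (V n))"

definition graded_maps :: "'u graded \<Rightarrow> 'v graded \<Rightarrow> (nat \<Rightarrow> 'u \<Rightarrow> 'v) set" where
  "graded_maps V W =
     {f. \<forall>n. f n \<in> carrier (V n) \<rightarrow> carrier (W n) \<and>
         (\<forall>x \<in> carrier (V n). \<forall>y \<in> carrier (V n).
            f n (x \<oplus>\<^bsub>V n\<^esub> y) = f n x \<oplus>\<^bsub>W n\<^esub> f n y) \<and>
         (\<forall>c. \<forall>x \<in> carrier (V n). f n (c \<odot>\<^bsub>V n\<^esub> x) = c \<odot>\<^bsub>W n\<^esub> f n x)}"


section \<open>Commutative differential graded algebras\<close>

record 'u dga =
  dga_comp :: "'u graded"
  dga_mult :: "nat \<Rightarrow> nat \<Rightarrow> 'u \<Rightarrow> 'u \<Rightarrow> 'u"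
  dga_unit :: 'u
  dga_diff :: "nat \<Rightarrow> 'u \<Rightarrow> 'u"

locale dga =
  fixes A :: "'u dga"
  assumes space: "graded_space (dga_comp A)"
    and mult_closed:
      "\<lbrakk>x \<in> carrier (dga_comp A m); y \<in> carrier (dga_comp A n)\<rbrakk>
        \<Longrightarrow> dga_mult A m n x y \<in> carrier (dga_comp A (m + n))"
    and mult_add_left:
      "\<lbrakk>x \<in> carrier (dga_comp A m); x' \<in> carrier (dga_comp A m); y \<in> carrier (dga_comp A n)\<rbrakk>
        \<Longrightarrow> dga_mult A m n (x \<oplus>\<^bsub>dga_comp A m\<^esub> x') y =
            dga_mult A m n x y \<oplus>\<^bsub>dga_comp A (m + n)\<^esub> dga_mult A m n x' y"
    and mult_add_right:
      "\<lbrakk>x \<in> carrier (dga_comp A m); y \<in> carrier (dga_comp A n); y' \<in> carrier (dga_comp A n)\<rbrakk>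
        \<Longrightarrow> dga_mult A m n x (y \<oplus>\<^bsub>dga_comp A n\<^esub> y') =
            dga_mult A m n x y \<oplus>\<^bsub>dga_comp A (m + n)\<^esub> dga_mult A m n x y'"
    and mult_smult_left:
      "\<lbrakk>x \<in> carrier (dga_comp A m); y \<in> carrier (dga_comp A n)\<rbrakk>
        \<Longrightarrow> dga_mult A m n (c \<odot>\<^bsub>dga_comp A m\<^esub> x) y =
            c \<odot>\<^bsub>dga_comp A (m + n)\<^esub> dga_mult A m n x y"
    and mult_smult_right:
      "\<lbrakk>x \<in> carrier (dga_comp A m); y \<in> carrier (dga_comp A n)\<rbrakk>
        \<Longrightarrow> dga_mult A m n x (c \<odot>\<^bsub>dga_comp A n\<^esub> y) =
            c \<odot>\<^bsub>dga_comp A (m + n)\<^esub> dga_mult A m n x y"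
    and mult_assoc:
      "\<lbrakk>x \<in> carrier (dga_comp A k); y \<in> carrier (dga_comp A m); z \<in> carrier (dga_comp A n)\<rbrakk>
        \<Longrightarrow> dga_mult A (k + m) n (dga_mult A k m x y) z =
            dga_mult A k (m + n) x (dga_mult A m n y z)"
    and unit_closed: "dga_unit A \<in> carrier (dga_comp A 0)"
    and mult_unit_left:
      "x \<in> carrier (dga_comp A n) \<Longrightarrow> dga_mult A 0 n (dga_unit A) x = x"
    and mult_unit_right:
      "x \<in> carrier (dga_comp A n) \<Longrightarrow> dga_mult A n 0 x (dga_unit A) = x"
    and mult_comm:
      "\<lbrakk>x \<in> carrier (dga_comp A m); y \<in> carrier (dga_comp A n)\<rbrakk>
        \<Longrightarrow> dga_mult A m n x y =
            ((-1) ^ (m * n)) \<odot>\<^bsub>dga_comp A (m + n)\<^esub> dga_mult A n m y x"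
    and diff_map:
      "dga_diff A \<in> graded_maps (dga_comp A) (\<lambda>n. dga_comp A (Suc n))"
    and diff_diff:
      "x \<in> carrier (dga_comp A n)
        \<Longrightarrow> dga_diff A (Suc n) (dga_diff A n x) = \<zero>\<^bsub>dga_comp A (Suc (Suc n))\<^esub>"
    and leibniz:
      "\<lbrakk>x \<in> carrier (dga_comp A m); y \<in> carrier (dga_comp A n)\<rbrakk>
        \<Longrightarrow> dga_diff A (m + n) (dga_mult A m n x y) =
            dga_mult A (Suc m) n (dga_diff A m x) y \<oplus>\<^bsub>dga_comp A (Suc (m + n))\<^esub>
            ((-1) ^ m) \<odot>\<^bsub>dga_comp A (Suc (m + n))\<^esub> dga_mult A m (Suc n) x (dga_diff A n y)"

definition dga_maps :: "'u dga \<Rightarrow> 'v dga \<Rightarrow> (nat \<Rightarrow> 'u \<Rightarrow> 'v) set" where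
  "dga_maps A B =
     {f \<in> graded_maps (dga_comp A) (dga_comp B).
        f 0 (dga_unit A) = dga_unit B \<and>
        (\<forall>m n. \<forall>x \<in> carrier (dga_comp A m). \<forall>y \<in> carrier (dga_comp A n).
           f (m + n) (dga_mult A m n x y) = dga_mult B m n (f m x) (f n y)) \<and>
        (\<forall>n. \<forall>x \<in> carrier (dga_comp A n). f (Suc n) (dga_diff A n x) = dga_diff B n (f n x))}"

definition cocycles :: "'u dga \<Rightarrow> nat \<Rightarrow> 'u set" where
  "cocycles A n = {x \<in> carrier (dga_comp A n). dga_diff A n x = \<zero>\<^bsub>dga_comp A (Suc n)\<^esub>}"

definition coboundaries :: "'u dga \<Rightarrow> nat \<Rightarrow> 'u set" where
  "coboundaries A n =
     (case n of 0 \<Rightarrow> {\<zero>\<^bsub>dga_comp A 0\<^esub>} | Suc k \<Rightarrow> dga_diff A k ` carrier (dga_comp A k))"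

definition coh_class :: "'u dga \<Rightarrow> nat \<Rightarrow> 'u \<Rightarrow> 'u set" where
  "coh_class A n z = coboundaries A n +>\<^bsub>dga_comp A n\<^esub> z"

definition cohomology :: "'u dga \<Rightarrow> nat \<Rightarrow> 'u set set" where
  "cohomology A n = coh_class A n ` cocycles A n"

text \<open>
  \<open>H\<^sup>0 = \<rat>\<close> means that the unit map \<open>\<rat> \<rightarrow> H\<^sup>0\<close>, \<open>c \<mapsto> [c \<cdot> 1]\<close>, is an isomorphism; it is always
  a homomorphism of algebras, so only bijectivity has to be required.
\<close>

definition coh_1_connected :: "'u dga \<Rightarrow> bool" where
  "coh_1_connected A \<longleftrightarrow>
     bij_betw (\<lambda>c :: rat. coh_class A 0 (c \<odot>\<^bsub>dga_comp A 0\<^esub> dga_unit A)) UNIV (cohomology A 0) \<and>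
     cohomology A 1 = {coh_class A 1 \<zero>\<^bsub>dga_comp A 1\<^esub>}"


section \<open>Covariant diagrams on the orbit category\<close>

text \<open>
  \<open>dmap D S T f\<close> is the map induced by \<open>f : S \<rightarrow> T\<close>. The target \<open>T\<close> is an argument because it
  cannot be recovered from the function \<open>f\<close>.
\<close>

record ('g, 'o, 'u) diagram =
  dob :: "'g set set \<Rightarrow> 'o"
  dmap :: "'g set set \<Rightarrow> 'g set set \<Rightarrow> ('g set \<Rightarrow> 'g set) \<Rightarrow> nat \<Rightarrow> 'u \<Rightarrow> 'u"

type_synonym ('g, 'u) vec_diagram = "('g, 'u graded, 'u) diagram"
type_synonym ('g, 'u) dga_diagram = "('g, 'u dga, 'u) diagram"

text \<open>
  The objects and morphisms of \<open>Vec\<^sup>*\<^sub>G\<close>. Maps of graded spaces are compared on the carriers only;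
  their values elsewhere are meaningless.
\<close>

locale vec_functor =
  fixes G :: "('g, 'm) monoid_scheme" and V :: "('g, 'u) vec_diagram"
  assumes ob: "S \<in> orbits G \<Longrightarrow> graded_space (dob V S)"
    and map:
      "\<lbrakk>S \<in> orbits G; T \<in> orbits G; f \<in> orbit_maps G S T\<rbrakk>
        \<Longrightarrow> dmap V S T f \<in> graded_maps (dob V S) (dob V T)"
    and map_id:
      "\<lbrakk>S \<in> orbits G; x \<in> carrier (dob V S n)\<rbrakk> \<Longrightarrow> dmap V S S (\<lambda>t \<in> S. t) n x = x"
    and map_comp:
      "\<lbrakk>S \<in> orbits G; T \<in> orbits G; U \<in> orbits G;
        f \<in> orbit_maps G S T; g \<in> orbit_maps G T U; x \<in> carrier (dob V S n)\<rbrakk>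
        \<Longrightarrow> dmap V S U (compose S g f) n x = dmap V T U g n (dmap V S T f n x)"

definition vec_maps ::
    "('g, 'm) monoid_scheme \<Rightarrow> ('g, 'u) vec_diagram \<Rightarrow> ('g, 'v) vec_diagram
      \<Rightarrow> ('g set set \<Rightarrow> nat \<Rightarrow> 'u \<Rightarrow> 'v) set" where
  "vec_maps G V W =
     {\<eta>. (\<forall>S \<in> orbits G. \<eta> S \<in> graded_maps (dob V S) (dob W S)) \<and>
         (\<forall>S \<in> orbits G. \<forall>T \<in> orbits G. \<forall>f \<in> orbit_maps G S T. \<forall>n.
            \<forall>x \<in> carrier (dob V S n).
              \<eta> T n (dmap V S T f n x) = dmap W S T f n (\<eta> S n x))}"

definition vec_inj_map ::
    "('g, 'm) monoid_scheme \<Rightarrow> ('g, 'u) vec_diagram \<Rightarrow> ('g set set \<Rightarrow> nat \<Rightarrow> 'u \<Rightarrow> 'v) \<Rightarrow> bool" where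
  "vec_inj_map G V \<eta> \<longleftrightarrow> (\<forall>S \<in> orbits G. \<forall>n. inj_on (\<eta> S n) (carrier (dob V S n)))"

text \<open>
  The type \<open>'u\<close> plays the role of a universe: the test objects \<open>V\<close>, \<open>W\<close> run over the
  diagrams whose carriers are subsets of \<open>'u\<close>, with arbitrary vector space structures. As a
  hypothesis this is implied by
  injectivity against test objects of all sizes. Conversely, by Baer's criterion injectivity can
  be tested on subobjects of the representable diagrams \<open>\<rat>[Hom(G/H, -)]\<close> placed in one degree,
  which for finite \<open>G\<close> are finite-dimensional; so nothing is lost as soon as \<open>'u\<close> is infinite. This
  holds whenever \<open>'u\<close> carries a DGA with \<open>H\<^sup>0 = \<rat>\<close>.
\<close>

definition vec_injective :: "('g, 'm) monoid_scheme \<Rightarrow> ('g, 'u) vec_diagram \<Rightarrow> bool" where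
  "vec_injective G I \<longleftrightarrow> vec_functor G I \<and>
     (\<forall>(V :: ('g, 'u) vec_diagram) (W :: ('g, 'u) vec_diagram) f g.
        vec_functor G V \<and> vec_functor G W \<and>
        f \<in> vec_maps G V W \<and> vec_inj_map G V f \<and> g \<in> vec_maps G V I \<longrightarrow>
        (\<exists>h \<in> vec_maps G W I. \<forall>S \<in> orbits G. \<forall>n. \<forall>x \<in> carrier (dob V S n).
           h S n (f S n x) = g S n x))"

definition forget :: "('g, 'u) dga_diagram \<Rightarrow> ('g, 'u) vec_diagram" where
  "forget D = \<lparr>dob = \<lambda>S. dga_comp (dob D S), dmap = dmap D\<rparr>"

text \<open>
  The objects of \<open>O\<^sub>G[DGA]\<close>. Identities and composites of DGA maps are those of the underlying graded
  maps, so functoriality is inherited from \<open>forget D\<close>.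
\<close>

locale dga_functor =
  fixes G :: "('g, 'm) monoid_scheme" and D :: "('g, 'u) dga_diagram"
  assumes vec: "vec_functor G (forget D)"
    and ob_dga: "S \<in> orbits G \<Longrightarrow> dga (dob D S)"
    and ob_connected: "S \<in> orbits G \<Longrightarrow> coh_1_connected (dob D S)"
    and map_dga:
      "\<lbrakk>S \<in> orbits G; T \<in> orbits G; f \<in> orbit_maps G S T\<rbrakk>
        \<Longrightarrow> dmap D S T f \<in> dga_maps (dob D S) (dob D T)"

definition structure_map ::
    "('g, 'm) monoid_scheme \<Rightarrow> ('g, 'u) dga_diagram \<Rightarrow> 'g set \<Rightarrow> 'g set \<Rightarrow> nat \<Rightarrow> 'u \<Rightarrow> 'u" where
  "structure_map G D H K = dmap D (lcosets\<^bsub>G\<^esub> H) (lcosets\<^bsub>G\<^esub> K) (orbit_proj G H K)"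

end

theory Submission
  imports Defs "HOL-Library.Countable_Set"
begin

text \<open>
  Write \<open>P\<^sub>S = \<rat>[Hom(S, -)]\<close> for the diagram represented by an orbit \<open>S\<close>. By the Yoneda lemma an
  element \<open>z\<close> of \<open>M(S')\<close>, in a fixed degree, is the same thing as a map \<open>P\<^sub>S\<^sub>' \<rightarrow> M\<close>. A surjection of
  orbits \<open>p : S \<rightarrow> S'\<close> is an epimorphism, so \<open>a \<mapsto> a \<circ> p\<close> is injective on each \<open>Hom(S', T)\<close>, and
  precomposition with \<open>p\<close> is an injective map \<open>P\<^sub>S\<^sub>' \<rightarrow> P\<^sub>S\<close>. If \<open>M\<close> is injective, the map \<open>P\<^sub>S\<^sub>' \<rightarrow> M\<close>
  that classifies \<open>z\<close> therefore extends to some \<open>h : P\<^sub>S \<rightarrow> M\<close>; in other words \<open>z\<close> is the image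
  under \<open>M(p)\<close> of the element \<open>h(id\<^sub>S)\<close> of \<open>M(S)\<close>. Hence \<open>M(p)\<close> is surjective
  (\<open>vec_injective_surj\<close>), and the theorem is the case of the projections \<open>G/H \<rightarrow> G/K\<close>.

  The diagrams \<open>P\<^sub>S\<close> do not live in the type \<open>'u\<close> over which the test objects for injectivity range.
  For a finite group they are finite-dimensional over \<open>\<rat>\<close>, hence countable, while \<open>'u\<close> is infinite
  because the unit of a DGA with \<open>H\<^sup>0 = \<rat>\<close> has infinitely many multiples. So the \<open>P\<^sub>S\<close> have
  isomorphic copies in \<open>'u\<close>, and injectivity applies to them (\<open>vec_injective_extend\<close>).
\<close>

section \<open>Linear maps and free vector spaces\<close>
lemma rat_field_simps [simp]:
  "carrier rat_field = UNIV" "\<zero>\<^bsub>rat_field\<^esub> = 0" "\<one>\<^bsub>rat_field\<^esub> = 1"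
  "a \<oplus>\<^bsub>rat_field\<^esub> b = a + b" "a \<otimes>\<^bsub>rat_field\<^esub> b = a * b"
  by (simp_all add: ring_of_type_algebra_def)

lemma rat_moduleI:
  fixes M (structure)
  assumes "\<And>x y. \<lbrakk>x \<in> carrier M; y \<in> carrier M\<rbrakk> \<Longrightarrow> x \<oplus> y \<in> carrier M"
    and "\<zero> \<in> carrier M"
    and "\<And>x y z. \<lbrakk>x \<in> carrier M; y \<in> carrier M; z \<in> carrier M\<rbrakk> \<Longrightarrow> (x \<oplus> y) \<oplus> z = x \<oplus> (y \<oplus> z)"
    and "\<And>x y. \<lbrakk>x \<in> carrier M; y \<in> carrier M\<rbrakk> \<Longrightarrow> x \<oplus> y = y \<oplus> x"
    and "\<And>x. x \<in> carrier M \<Longrightarrow> \<zero> \<oplus> x = x"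
    and "\<And>x. x \<in> carrier M \<Longrightarrow> \<exists>y \<in> carrier M. y \<oplus> x = \<zero>"
    and "\<And>c x. x \<in> carrier M \<Longrightarrow> c \<odot> x \<in> carrier M"
    and "\<And>b c x. x \<in> carrier M \<Longrightarrow> (b + c) \<odot> x = (b \<odot> x) \<oplus> (c \<odot> x)"
    and "\<And>c x y. \<lbrakk>x \<in> carrier M; y \<in> carrier M\<rbrakk> \<Longrightarrow> c \<odot> (x \<oplus> y) = (c \<odot> x) \<oplus> (c \<odot> y)"
    and "\<And>b c x. x \<in> carrier M \<Longrightarrow> (b * c) \<odot> x = b \<odot> (c \<odot> x)"
    and "\<And>x. x \<in> carrier M \<Longrightarrow> 1 \<odot> x = x"
  shows "module rat_field M"
  by (rule moduleI[OF cring_from_type_algebra abelian_groupI];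
      (simp only: rat_field_simps)?; rule assms; assumption)

definition linear_maps :: "(rat, 'u) module \<Rightarrow> (rat, 'v) module \<Rightarrow> ('u \<Rightarrow> 'v) set" where
  "linear_maps M N =
     {f \<in> carrier M \<rightarrow> carrier N.
        (\<forall>x \<in> carrier M. \<forall>y \<in> carrier M. f (x \<oplus>\<^bsub>M\<^esub> y) = f x \<oplus>\<^bsub>N\<^esub> f y) \<and>
        (\<forall>c. \<forall>x \<in> carrier M. f (c \<odot>\<^bsub>M\<^esub> x) = c \<odot>\<^bsub>N\<^esub> f x)}"

lemma graded_maps_iff: "f \<in> graded_maps V W \<longleftrightarrow> (\<forall>n. f n \<in> linear_maps (V n) (W n))"
  by (auto simp: graded_maps_def linear_maps_def)

lemma linear_maps_comp:
  assumes "f \<in> linear_maps M N" "g \<in> linear_maps N P"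
  shows "(\<lambda>x. g (f x)) \<in> linear_maps M P"
  using assms by (simp add: linear_maps_def Pi_iff)

lemma linear_maps_closed: "f \<in> linear_maps M N \<Longrightarrow> x \<in> carrier M \<Longrightarrow> f x \<in> carrier N"
  by (auto simp: linear_maps_def)

text \<open>
  The vector space with basis \<open>B\<close>, as the functions that vanish outside \<open>B\<close>. This is the free space
  only for finite \<open>B\<close>, which is the case that occurs for sets of maps between finite orbits.
\<close>
definition free_space :: "'a set \<Rightarrow> (rat, 'a \<Rightarrow> rat) module" where
  "free_space B =
     \<lparr>carrier = {\<phi>. \<forall>a. a \<notin> B \<longrightarrow> \<phi> a = 0}, monoid.mult = undefined, one = undefined,
      ring.zero = (\<lambda>_. 0), add = (\<lambda>\<phi> \<psi> a. \<phi> a + \<psi> a), module.smult = (\<lambda>c \<phi> a. c * \<phi> a)\<rparr>"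

lemma free_space_simps [simp]:
  "\<phi> \<in> carrier (free_space B) \<longleftrightarrow> (\<forall>a. a \<notin> B \<longrightarrow> \<phi> a = 0)"
  "\<zero>\<^bsub>free_space B\<^esub> = (\<lambda>_. 0)"
  "\<phi> \<oplus>\<^bsub>free_space B\<^esub> \<psi> = (\<lambda>a. \<phi> a + \<psi> a)"
  "c \<odot>\<^bsub>free_space B\<^esub> \<phi> = (\<lambda>a. c * \<phi> a)"
  by (simp_all add: free_space_def)

lemma module_free_space: "module rat_field (free_space B)"
proof (rule rat_moduleI)
  fix \<phi> assume "\<phi> \<in> carrier (free_space B)"
  then show "\<exists>\<psi> \<in> carrier (free_space B). \<psi> \<oplus>\<^bsub>free_space B\<^esub> \<phi> = \<zero>\<^bsub>free_space B\<^esub>"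
    by (intro bexI[of _ "\<lambda>a. - \<phi> a"]) auto
qed (auto simp: algebra_simps)

lemma countable_free_space:
  assumes "finite B"
  shows "countable (carrier (free_space B))"
  using assms
proof induction
  case empty
  have "carrier (free_space {}) = {\<lambda>_. 0}" by auto
  then show ?case by (metis countable_empty countable_insert)
next
  case (insert a B)
  have "carrier (free_space (insert a B)) \<subseteq> (\<lambda>(\<phi>, c). \<phi>(a := c)) ` (carrier (free_space B) \<times> UNIV)"
  proof
    fix \<phi> assume "\<phi> \<in> carrier (free_space (insert a B))"
    then show "\<phi> \<in> (\<lambda>(\<phi>, c). \<phi>(a := c)) ` (carrier (free_space B) \<times> UNIV)"
      by (intro image_eqI[of _ _ "(\<phi>(a := 0), \<phi> a)"]) auto
  qed
  then show ?case
    using insert.IH by (meson countable_SIGMA countable_image countableI_type countable_subset)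
qed

definition delta :: "'a \<Rightarrow> 'a \<Rightarrow> rat" where
  "delta a = (\<lambda>b. of_bool (b = a))"

lemma delta_in_free_space: "a \<in> B \<Longrightarrow> delta a \<in> carrier (free_space B)"
  by (auto simp: delta_def)

text \<open>
  Uniqueness of linear extension. All identities between maps out of representable diagrams are
  reduced by it to basis vectors, where they become identities between maps of orbits.
\<close>
lemma linear_maps_eq_on_delta:
  assumes "finite B" and M: "module rat_field M"
    and f: "f \<in> linear_maps (free_space B) M" and g: "g \<in> linear_maps (free_space B) M"
    and eq: "\<And>a. a \<in> B \<Longrightarrow> f (delta a) = g (delta a)"
    and \<phi>: "\<phi> \<in> carrier (free_space B)"
  shows "f \<phi> = g \<phi>"
proof -
  let ?F = "free_space B"
  interpret M: module rat_field M by (rule M)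
  have zero: "h (\<lambda>_. 0) = \<zero>\<^bsub>M\<^esub>" if h: "h \<in> linear_maps ?F M" for h
  proof -
    have "h (0 \<odot>\<^bsub>?F\<^esub> \<zero>\<^bsub>?F\<^esub>) = 0 \<odot>\<^bsub>M\<^esub> h \<zero>\<^bsub>?F\<^esub>" "h \<zero>\<^bsub>?F\<^esub> \<in> carrier M"
      using h module.axioms(2)[OF module_free_space, THEN abelian_groupE(2)]
      by (simp_all only: linear_maps_def mem_Collect_eq) blast+
    then show ?thesis using M.smult_l_null by simp
  qed
  have "\<forall>\<phi>. (\<forall>a. a \<notin> Y \<longrightarrow> \<phi> a = 0) \<longrightarrow> f \<phi> = g \<phi>" if "finite Y" "Y \<subseteq> B" for Y
    using that
  proof induction
    case empty
    have "\<phi> = (\<lambda>_. 0)" if "\<forall>a. a \<notin> {} \<longrightarrow> \<phi> a = 0" for \<phi> :: "'a \<Rightarrow> rat" using that by auto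
    then show ?case using zero[OF f] zero[OF g] by metis
  next
    case (insert a Y)
    show ?case
    proof (intro allI impI)
      \<comment> \<open>Split off the component at \<open>a\<close>; the rest is supported in \<open>Y\<close>.\<close>
      fix \<phi> :: "'a \<Rightarrow> rat" assume \<phi>: "\<forall>b. b \<notin> insert a Y \<longrightarrow> \<phi> b = 0"
      let ?\<psi> = "\<phi>(a := 0)" and ?\<chi> = "\<phi> a \<odot>\<^bsub>?F\<^esub> delta a"
      have split: "\<phi> = ?\<psi> \<oplus>\<^bsub>?F\<^esub> ?\<chi>" by (auto simp: delta_def)
      have in_F: "?\<psi> \<in> carrier ?F" "delta a \<in> carrier ?F" "?\<chi> \<in> carrier ?F"
        using \<phi> insert.prems by (auto simp: delta_def)
      have lin: "h \<phi> = h ?\<psi> \<oplus>\<^bsub>M\<^esub> \<phi> a \<odot>\<^bsub>M\<^esub> h (delta a)" if "h \<in> linear_maps ?F M" for h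
        using that in_F by (subst split) (simp only: linear_maps_def mem_Collect_eq)
      have "f ?\<psi> = g ?\<psi>" using insert \<phi> by auto
      then show "f \<phi> = g \<phi>" using lin[OF f] lin[OF g] eq insert.prems by auto
    qed
  qed
  then show ?thesis using assms(1) \<phi> by auto
qed

definition lin_ext :: "(rat, 'u) module \<Rightarrow> 'a set \<Rightarrow> ('a \<Rightarrow> 'u) \<Rightarrow> ('a \<Rightarrow> rat) \<Rightarrow> 'u" where
  "lin_ext M B y \<phi> = finsum M (\<lambda>a. \<phi> a \<odot>\<^bsub>M\<^esub> y a) B"

lemma lin_ext_linear:
  assumes "module rat_field M" and "finite B" and y: "\<And>a. a \<in> B \<Longrightarrow> y a \<in> carrier M"
  shows "lin_ext M B y \<in> linear_maps (free_space B) M"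
proof -
  interpret M: module rat_field M by fact
  have 1: "(\<lambda>a. \<phi> a \<odot>\<^bsub>M\<^esub> y a) \<in> B \<rightarrow> carrier M" for \<phi>
    using y by auto
  have "lin_ext M B y (\<lambda>a. \<phi> a + \<psi> a) = lin_ext M B y \<phi> \<oplus>\<^bsub>M\<^esub> lin_ext M B y \<psi>" for \<phi> \<psi>
    unfolding lin_ext_def M.finsum_addf[OF 1 1, symmetric] using y M.smult_l_distr
    by (intro M.finsum_cong') auto
  moreover have "lin_ext M B y (\<lambda>a. c * \<phi> a) = c \<odot>\<^bsub>M\<^esub> lin_ext M B y \<phi>" for c \<phi>
    unfolding lin_ext_def using y M.smult_assoc1 assms(2)
    by (subst M.finsum_smult_ldistr) (auto intro!: M.finsum_cong')
  ultimately show ?thesis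
    using 1 by (auto simp: linear_maps_def lin_ext_def)
qed

lemma lin_ext_delta:
  assumes "module rat_field M" and "finite B" and y: "\<And>a. a \<in> B \<Longrightarrow> y a \<in> carrier M" and a: "a \<in> B"
  shows "lin_ext M B y (delta a) = y a"
proof -
  interpret M: module rat_field M by fact
  have "lin_ext M B y (delta a) = finsum M (\<lambda>b. if a = b then y b else \<zero>\<^bsub>M\<^esub>) B"
    unfolding lin_ext_def using y M.smult_one M.smult_l_null
    by (intro M.finsum_cong') (auto simp: delta_def)
  also have "\<dots> = y a"
    using a assms(2) y by (intro M.finsum_singleton) auto
  finally show ?thesis .
qed

definition pushforward :: "'a set \<Rightarrow> ('a \<Rightarrow> 'b) \<Rightarrow> ('a \<Rightarrow> rat) \<Rightarrow> 'b \<Rightarrow> rat" where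
  "pushforward B g \<phi> = (\<lambda>b. \<Sum>a\<in>B. \<phi> a * delta (g a) b)"

lemma pushforward_linear:
  assumes "g \<in> B \<rightarrow> Y"
  shows "pushforward B g \<in> linear_maps (free_space B) (free_space Y)"
  using assms
  by (auto simp: linear_maps_def pushforward_def delta_def Pi_iff sum.distrib algebra_simps
      sum_distrib_left intro!: sum.neutral)

lemma pushforward_delta:
  assumes "finite B" "a \<in> B"
  shows "pushforward B g (delta a) = delta (g a)"
proof
  fix b
  have "pushforward B g (delta a) b = (\<Sum>c\<in>B. if c = a then delta (g a) b else 0)"
    unfolding pushforward_def by (intro sum.cong) (auto simp: delta_def)
  then show "pushforward B g (delta a) b = delta (g a) b" using assms by simp
qed

lemma inj_on_pushforward:
  assumes "finite B" "inj_on g B"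
  shows "inj_on (pushforward B g) (carrier (free_space B))"
proof (rule inj_onI, rule ext)
  have at_image: "pushforward B g \<phi> (g a) = \<phi> a" if "a \<in> B" for \<phi> a
  proof -
    have "pushforward B g \<phi> (g a) = (\<Sum>b\<in>B. if b = a then \<phi> a else 0)"
      unfolding pushforward_def using assms(2) that
      by (intro sum.cong) (auto simp: delta_def dest: inj_onD)
    then show ?thesis using assms(1) that by simp
  qed
  fix \<phi> \<psi> a
  assume "\<phi> \<in> carrier (free_space B)" "\<psi> \<in> carrier (free_space B)"
    "pushforward B g \<phi> = pushforward B g \<psi>"
  then show "\<phi> a = \<psi> a" using at_image[of a \<phi>] at_image[of a \<psi>] by (cases "a \<in> B") auto
qed


section \<open>Change of universe\<close>

text \<open>
  The inverse of \<open>e\<close> is the default-valued \<open>inv_into\<close>, so the operations agree with those of \<open>M\<close>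
  only when \<open>e\<close> is injective on the carrier.
\<close>
definition transport_module :: "('v \<Rightarrow> 'u) \<Rightarrow> (rat, 'v) module \<Rightarrow> (rat, 'u) module" where
  "transport_module e M =
     (let r = inv_into (carrier M) e in
      \<lparr>carrier = e ` carrier M, monoid.mult = undefined, one = undefined, ring.zero = e \<zero>\<^bsub>M\<^esub>,
       add = (\<lambda>x y. e (r x \<oplus>\<^bsub>M\<^esub> r y)), module.smult = (\<lambda>c x. e (c \<odot>\<^bsub>M\<^esub> r x))\<rparr>)"

lemma transport_module_simps:
  assumes "inj_on e (carrier M)"
  shows "carrier (transport_module e M) = e ` carrier M"
    and "\<zero>\<^bsub>transport_module e M\<^esub> = e \<zero>\<^bsub>M\<^esub>"
    and "\<lbrakk>x \<in> carrier M; y \<in> carrier M\<rbrakk> \<Longrightarrow> e x \<oplus>\<^bsub>transport_module e M\<^esub> e y = e (x \<oplus>\<^bsub>M\<^esub> y)"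
    and "x \<in> carrier M \<Longrightarrow> c \<odot>\<^bsub>transport_module e M\<^esub> e x = e (c \<odot>\<^bsub>M\<^esub> x)"
  using assms by (simp_all add: transport_module_def Let_def)

lemma module_transport_module:
  assumes "module rat_field M" and e: "inj_on e (carrier M)"
  shows "module rat_field (transport_module e M)"
proof -
  interpret M: module rat_field M by fact
  note [simp] = transport_module_simps[OF e]
  show ?thesis
  proof (rule rat_moduleI)
    fix x assume "x \<in> carrier (transport_module e M)"
    then obtain u where u: "u \<in> carrier M" "x = e u" by auto
    have "e (\<ominus>\<^bsub>M\<^esub> u) \<oplus>\<^bsub>transport_module e M\<^esub> x = \<zero>\<^bsub>transport_module e M\<^esub>"
      using u by (simp add: M.l_neg)
    then show "\<exists>y \<in> carrier (transport_module e M).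
        y \<oplus>\<^bsub>transport_module e M\<^esub> x = \<zero>\<^bsub>transport_module e M\<^esub>"
      using u by auto
  next
    fix b c x assume "x \<in> carrier (transport_module e M)"
    then show "(b + c) \<odot>\<^bsub>transport_module e M\<^esub> x =
        (b \<odot>\<^bsub>transport_module e M\<^esub> x) \<oplus>\<^bsub>transport_module e M\<^esub> (c \<odot>\<^bsub>transport_module e M\<^esub> x)"
      and "(b * c) \<odot>\<^bsub>transport_module e M\<^esub> x =
        b \<odot>\<^bsub>transport_module e M\<^esub> (c \<odot>\<^bsub>transport_module e M\<^esub> x)"
      and "1 \<odot>\<^bsub>transport_module e M\<^esub> x = x"
      using M.smult_l_distr[of b c] M.smult_assoc1[of b c] M.smult_one by auto
  qed (auto simp: M.a_ac M.smult_r_distr)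
qed

lemma transport_linear:
  assumes "inj_on e (carrier M)"
  shows "e \<in> linear_maps M (transport_module e M)"
  using transport_module_simps[OF assms] by (auto simp: linear_maps_def)

lemma transport_inv_linear:
  assumes "module rat_field M" and e: "inj_on e (carrier M)"
  shows "inv_into (carrier M) e \<in> linear_maps (transport_module e M) M"
proof -
  interpret M: module rat_field M by fact
  show ?thesis
    using transport_module_simps[OF e] e by (auto simp: linear_maps_def)
qed

definition transport ::
    "('g set set \<Rightarrow> nat \<Rightarrow> 'v \<Rightarrow> 'u) \<Rightarrow> ('g, 'v) vec_diagram \<Rightarrow> ('g, 'u) vec_diagram" where
  "transport e V =
     \<lparr>dob = \<lambda>S n. transport_module (e S n) (dob V S n),
      dmap = \<lambda>S T f n x. e T n (dmap V S T f n (inv_into (carrier (dob V S n)) (e S n) x))\<rparr>"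

lemma vec_functor_module: "vec_functor G V \<Longrightarrow> S \<in> orbits G \<Longrightarrow> module rat_field (dob V S n)"
  by (simp add: vec_functor_def graded_space_def)

lemma vec_functor_linear:
  "\<lbrakk>vec_functor G V; S \<in> orbits G; T \<in> orbits G; f \<in> orbit_maps G S T\<rbrakk>
    \<Longrightarrow> dmap V S T f n \<in> linear_maps (dob V S n) (dob V T n)"
  by (simp add: vec_functor_def graded_maps_iff)

context
  fixes G :: "('g, 'm) monoid_scheme" and V :: "('g, 'v) vec_diagram"
    and e :: "'g set set \<Rightarrow> nat \<Rightarrow> 'v \<Rightarrow> 'u"
  assumes V: "vec_functor G V"
    and e: "\<And>S n. S \<in> orbits G \<Longrightarrow> inj_on (e S n) (carrier (dob V S n))"
begin

lemma vec_functor_transport: "vec_functor G (transport e V)"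
proof
  fix S assume S: "S \<in> orbits G"
  then show "graded_space (dob (transport e V) S)"
    using vec_functor_module[OF V] e
    by (auto simp: graded_space_def transport_def intro!: module_transport_module)
next
  fix S T f assume *: "S \<in> orbits G" "T \<in> orbits G" "f \<in> orbit_maps G S T"
  show "dmap (transport e V) S T f \<in> graded_maps (dob (transport e V) S) (dob (transport e V) T)"
    unfolding graded_maps_iff transport_def diagram.simps
    by (intro allI linear_maps_comp[OF _ transport_linear[OF e]]
        linear_maps_comp[OF _ vec_functor_linear[OF V *]]
        transport_inv_linear vec_functor_module[OF V] e *)
next
  fix S x n assume S: "S \<in> orbits G" and "x \<in> carrier (dob (transport e V) S n)"
  then obtain u where u: "u \<in> carrier (dob V S n)" "x = e S n u"
    using transport_module_simps(1)[OF e[OF S]] by (auto simp: transport_def)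
  show "dmap (transport e V) S S (\<lambda>t \<in> S. t) n x = x"
    using u vec_functor.map_id[OF V S u(1)] e[OF S, of n] by (simp add: transport_def)
next
  fix S T U f g x n
  assume S: "S \<in> orbits G" and T: "T \<in> orbits G" and U: "U \<in> orbits G"
    and f: "f \<in> orbit_maps G S T" and g: "g \<in> orbit_maps G T U"
    and "x \<in> carrier (dob (transport e V) S n)"
  then obtain u where u: "u \<in> carrier (dob V S n)" "x = e S n u"
    using transport_module_simps(1)[OF e[OF S]] by (auto simp: transport_def)
  have "dmap V S T f n u \<in> carrier (dob V T n)"
    using linear_maps_closed[OF vec_functor_linear[OF V S T f] u(1)] .
  then show "dmap (transport e V) S U (compose S g f) n x =
      dmap (transport e V) T U g n (dmap (transport e V) S T f n x)"
    using u vec_functor.map_comp[OF V S T U f g u(1)] e[OF S, of n] e[OF T, of n]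
    by (simp add: transport_def)
qed

lemma transport_vec_map: "e \<in> vec_maps G V (transport e V)"
  using e by (auto simp: vec_maps_def graded_maps_iff transport_def intro!: transport_linear)

lemma transport_inv_vec_map:
  "(\<lambda>S n. inv_into (carrier (dob V S n)) (e S n)) \<in> vec_maps G (transport e V) V"
proof -
  have "inv_into (carrier (dob V T n)) (e T n) (dmap (transport e V) S T f n x) =
      dmap V S T f n (inv_into (carrier (dob V S n)) (e S n) x)"
    if S: "S \<in> orbits G" and T: "T \<in> orbits G" and f: "f \<in> orbit_maps G S T"
      and x: "x \<in> carrier (dob (transport e V) S n)" for S T f n x
  proof -
    obtain u where u: "u \<in> carrier (dob V S n)" "x = e S n u"
      using x transport_module_simps(1)[OF e[OF S]] by (auto simp: transport_def)
    have "dmap V S T f n u \<in> carrier (dob V T n)"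
      using linear_maps_closed[OF vec_functor_linear[OF V S T f] u(1)] .
    then show ?thesis using u e[OF S, of n] e[OF T, of n] by (simp add: transport_def)
  qed
  then show ?thesis
    using vec_functor_module[OF V] e
    by (auto simp: vec_maps_def graded_maps_iff transport_def intro!: transport_inv_linear)
qed

end

lemma vec_maps_closed:
  "\<lbrakk>f \<in> vec_maps G V W; S \<in> orbits G; x \<in> carrier (dob V S n)\<rbrakk> \<Longrightarrow> f S n x \<in> carrier (dob W S n)"
  unfolding vec_maps_def graded_maps_iff by (blast intro: linear_maps_closed)

lemma vec_maps_comp:
  assumes f: "f \<in> vec_maps G V W" and g: "g \<in> vec_maps G W U"
  shows "(\<lambda>S n x. g S n (f S n x)) \<in> vec_maps G V U"
proof -
  have "f S n x \<in> carrier (dob W S n)" if "S \<in> orbits G" "x \<in> carrier (dob V S n)" for S n x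
    using vec_maps_closed[OF f that] .
  moreover have "(\<lambda>x. g S n (f S n x)) \<in> linear_maps (dob V S n) (dob U S n)"
    if "S \<in> orbits G" for S n
    using f g that unfolding vec_maps_def graded_maps_iff by (blast intro: linear_maps_comp)
  ultimately show ?thesis
    using f g by (simp add: vec_maps_def graded_maps_iff)
qed

text \<open>
  The extension property holds for test diagrams over any types, provided that their carriers
  embed in \<open>'u\<close>: extend from copies of \<open>V\<close> and \<open>W\<close> inside \<open>'u\<close> and transport the result back. The
  embeddings may be chosen separately for each orbit and degree, since the structure maps of a
  diagram are transported along with its spaces.
\<close>
lemma vec_injective_extend:
  fixes I :: "('g, 'u) vec_diagram" and V :: "('g, 'v) vec_diagram" and W :: "('g, 'w) vec_diagram"
  assumes I: "vec_injective G I" and V: "vec_functor G V" and W: "vec_functor G W"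
    and f: "f \<in> vec_maps G V W" and f_inj: "vec_inj_map G V f" and g: "g \<in> vec_maps G V I"
    and "\<And>S n. S \<in> orbits G \<Longrightarrow> \<exists>e :: 'v \<Rightarrow> 'u. inj_on e (carrier (dob V S n))"
    and "\<And>S n. S \<in> orbits G \<Longrightarrow> \<exists>e :: 'w \<Rightarrow> 'u. inj_on e (carrier (dob W S n))"
  shows "\<exists>h \<in> vec_maps G W I. \<forall>S \<in> orbits G. \<forall>n. \<forall>x \<in> carrier (dob V S n).
           h S n (f S n x) = g S n x"
proof -
  define e :: "'g set set \<Rightarrow> nat \<Rightarrow> 'v \<Rightarrow> 'u"
    where "e S n = (SOME e. inj_on e (carrier (dob V S n)))" for S n
  define k :: "'g set set \<Rightarrow> nat \<Rightarrow> 'w \<Rightarrow> 'u"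
    where "k S n = (SOME e. inj_on e (carrier (dob W S n)))" for S n
  have e: "inj_on (e S n) (carrier (dob V S n))" if "S \<in> orbits G" for S n
    unfolding e_def by (rule someI_ex[OF assms(7)[OF that]])
  have k: "inj_on (k S n) (carrier (dob W S n))" if "S \<in> orbits G" for S n
    unfolding k_def by (rule someI_ex[OF assms(8)[OF that]])
  define r where "r S n = inv_into (carrier (dob V S n)) (e S n)" for S n
  let ?V = "transport e V" and ?W = "transport k W"
  have r: "r \<in> vec_maps G ?V V"
    unfolding r_def by (rule transport_inv_vec_map[OF V e])
  have f': "(\<lambda>S n x. k S n (f S n (r S n x))) \<in> vec_maps G ?V ?W"
    by (rule vec_maps_comp[OF vec_maps_comp[OF r f] transport_vec_map[OF W k]])
  have "inj_on (\<lambda>x. k S n (f S n (r S n x))) (carrier (dob ?V S n))" if S: "S \<in> orbits G" for S n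
  proof -
    have "inj_on (f S n) (carrier (dob V S n))"
      using f_inj S by (simp add: vec_inj_map_def)
    moreover have "carrier (dob ?V S n) = e S n ` carrier (dob V S n)"
      using transport_module_simps(1)[OF e[OF S]] by (simp add: transport_def)
    ultimately show ?thesis
      using vec_maps_closed[OF f S] e[OF S, of n] k[OF S, of n]
      by (auto simp: inj_on_def r_def) metis
  qed
  then have "vec_inj_map G ?V (\<lambda>S n x. k S n (f S n (r S n x)))"
    by (simp add: vec_inj_map_def)
  then obtain h where h: "h \<in> vec_maps G ?W I"
    and hf: "\<And>S n x. S \<in> orbits G \<Longrightarrow> x \<in> carrier (dob ?V S n)
      \<Longrightarrow> h S n (k S n (f S n (r S n x))) = g S n (r S n x)"
    using I f' vec_functor_transport[OF V e] vec_functor_transport[OF W k] vec_maps_comp[OF r g]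
    unfolding vec_injective_def by blast
  have "h S n (k S n (f S n x)) = g S n x" if S: "S \<in> orbits G" and x: "x \<in> carrier (dob V S n)" for S n x
    using hf[OF S vec_maps_closed[OF transport_vec_map[OF V e] S x]] x e[OF S, of n]
    by (simp add: r_def)
  then show ?thesis
    by (intro bexI[OF _ vec_maps_comp[OF transport_vec_map[OF W k] h]]) simp_all
qed


section \<open>Representable diagrams\<close>

text \<open>
  The diagram \<open>\<rat>[Hom(S, -)]\<close>, with the same space in every degree. Since there is no differential
  here the degrees do not interact, and a map to \<open>M\<close> can be prescribed independently in each.
\<close>
definition representable :: "('g, 'm) monoid_scheme \<Rightarrow> 'g set set
    \<Rightarrow> ('g, ('g set \<Rightarrow> 'g set) \<Rightarrow> rat) vec_diagram" where
  "representable G S =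
     \<lparr>dob = \<lambda>T n. free_space (orbit_maps G S T),
      dmap = \<lambda>T U f n. pushforward (orbit_maps G S T) (compose S f)\<rparr>"

text \<open>
  The Yoneda correspondence: the map \<open>\<rat>[Hom(S, -)] \<rightarrow> M\<close> that takes the basis vector of the
  identity of \<open>S\<close> in degree \<open>n\<close> to \<open>y n\<close>.
\<close>
definition yoneda_map :: "('g, 'm) monoid_scheme \<Rightarrow> 'g set set \<Rightarrow> ('g, 'u) vec_diagram \<Rightarrow> (nat \<Rightarrow> 'u)
    \<Rightarrow> 'g set set \<Rightarrow> nat \<Rightarrow> (('g set \<Rightarrow> 'g set) \<Rightarrow> rat) \<Rightarrow> 'u" where
  "yoneda_map G S M y T n = lin_ext (dob M T n) (orbit_maps G S T) (\<lambda>a. dmap M S T a n (y n))"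

definition precompose :: "('g, 'm) monoid_scheme \<Rightarrow> 'g set set \<Rightarrow> 'g set set \<Rightarrow> ('g set \<Rightarrow> 'g set)
    \<Rightarrow> 'g set set \<Rightarrow> nat \<Rightarrow> (('g set \<Rightarrow> 'g set) \<Rightarrow> rat) \<Rightarrow> ('g set \<Rightarrow> 'g set) \<Rightarrow> rat" where
  "precompose G S S' f T n = pushforward (orbit_maps G S' T) (\<lambda>a. compose S a f)"

context group
begin

text \<open>
  Composites in the orbit category are restricted to their source; equivariance survives this
  restriction because an orbit is closed under translation.
\<close>
lemma orbits_translate:
  assumes "S \<in> orbits G" "g \<in> carrier G" "x \<in> S"
  shows "g <# x \<in> S"
proof -
  obtain H where H: "subgroup H G" "S = lcosets H"
    using assms(1) by (auto simp: orbits_def)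
  then obtain a where "a \<in> carrier G" "x = a <# H"
    using assms(3) by (auto simp: LCOSETS_def)
  then show ?thesis
    using H assms(2) lcos_m_assoc[OF subgroup.subset[OF H(1)]] by (auto simp: LCOSETS_def)
qed

lemma orbit_maps_Pi: "f \<in> orbit_maps G S T \<Longrightarrow> f \<in> S \<rightarrow> T"
  by (auto simp: orbit_maps_def)

lemma orbit_maps_extensional: "f \<in> orbit_maps G S T \<Longrightarrow> f \<in> extensional S"
  by (auto simp: orbit_maps_def PiE_def)

lemma orbit_maps_id: "S \<in> orbits G \<Longrightarrow> (\<lambda>x \<in> S. x) \<in> orbit_maps G S S"
  by (auto simp: orbit_maps_def orbits_translate)

lemma orbit_maps_compose:
  assumes "S \<in> orbits G" "f \<in> orbit_maps G S T" "g \<in> orbit_maps G T U"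
  shows "compose S g f \<in> orbit_maps G S U"
  using assms orbits_translate[OF assms(1)]
  by (auto simp: orbit_maps_def compose_def PiE_iff)

lemma finite_orbit_maps:
  assumes "finite (carrier G)" "S \<in> orbits G" "T \<in> orbits G"
  shows "finite (orbit_maps G S T)"
proof -
  have "finite U" if "U \<in> orbits G" for U
    using that assms(1) lcosets_subset_PowG by (auto simp: orbits_def intro: finite_subset)
  then have "finite (S \<rightarrow>\<^sub>E T)" using assms by (intro finite_PiE) auto
  then show ?thesis by (rule finite_subset[rotated]) (auto simp: orbit_maps_def)
qed

context
  assumes finite_G: "finite (carrier G)"
begin

lemma representable_linear:
  assumes "S \<in> orbits G" "f \<in> orbit_maps G T U"
  shows "dmap (representable G S) T U f n \<in> linear_maps (dob (representable G S) T n) (dob (representable G S) U n)"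
  using assms by (auto simp: representable_def intro!: pushforward_linear orbit_maps_compose)

lemma representable_delta:
  assumes "S \<in> orbits G" "T \<in> orbits G" "a \<in> orbit_maps G S T"
  shows "dmap (representable G S) T U f n (delta a) = delta (compose S f a)"
  using assms by (simp add: representable_def pushforward_delta finite_orbit_maps[OF finite_G])

lemma representable_eqI:
  assumes S: "S \<in> orbits G" and T: "T \<in> orbits G" and M: "module rat_field M"
    and "f \<in> linear_maps (dob (representable G S) T n) M"
    and "g \<in> linear_maps (dob (representable G S) T n) M"
    and "\<And>a. a \<in> orbit_maps G S T \<Longrightarrow> f (delta a) = g (delta a)"
    and "\<phi> \<in> carrier (dob (representable G S) T n)"
  shows "f \<phi> = g \<phi>"
  using assms(4-) linear_maps_eq_on_delta[OF finite_orbit_maps[OF finite_G S T] M]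
  by (simp add: representable_def)

lemma module_representable: "module rat_field (dob (representable G S) T n)"
  by (simp add: representable_def module_free_space)

lemma vec_functor_representable:
  assumes S: "S \<in> orbits G"
  shows "vec_functor G (representable G S)"
proof
  fix T show "graded_space (dob (representable G S) T)"
    by (simp add: graded_space_def module_representable)
next
  fix T U f assume "f \<in> orbit_maps G T U"
  then show "dmap (representable G S) T U f \<in>
      graded_maps (dob (representable G S) T) (dob (representable G S) U)"
    using representable_linear[OF S] by (simp add: graded_maps_iff)
next
  fix T \<phi> n assume T: "T \<in> orbits G" and \<phi>: "\<phi> \<in> carrier (dob (representable G S) T n)"
  show "dmap (representable G S) T T (\<lambda>t \<in> T. t) n \<phi> = \<phi>"
  proof (rule representable_eqI[OF S T module_representable _ _ _ \<phi>])
    show "dmap (representable G S) T T (\<lambda>t \<in> T. t) n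
        \<in> linear_maps (dob (representable G S) T n) (dob (representable G S) T n)"
      by (intro representable_linear S orbit_maps_id T)
    show "(\<lambda>\<phi>. \<phi>) \<in> linear_maps (dob (representable G S) T n) (dob (representable G S) T n)"
      by (simp add: linear_maps_def)
    fix a assume a: "a \<in> orbit_maps G S T"
    have "compose S (\<lambda>t \<in> T. t) a = a"
      using orbit_maps_Pi[OF a] orbit_maps_extensional[OF a] by (rule Id_compose)
    then show "dmap (representable G S) T T (\<lambda>t \<in> T. t) n (delta a) = delta a"
      by (simp add: representable_delta[OF S T a])
  qed
next
  fix T U V f g \<phi> n
  assume T: "T \<in> orbits G" and U: "U \<in> orbits G" and "V \<in> orbits G"
    and f: "f \<in> orbit_maps G T U" and g: "g \<in> orbit_maps G U V"
    and \<phi>: "\<phi> \<in> carrier (dob (representable G S) T n)"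
  show "dmap (representable G S) T V (compose T g f) n \<phi> =
      dmap (representable G S) U V g n (dmap (representable G S) T U f n \<phi>)"
  proof (rule representable_eqI[OF S T module_representable _ _ _ \<phi>])
    show "dmap (representable G S) T V (compose T g f) n
        \<in> linear_maps (dob (representable G S) T n) (dob (representable G S) V n)"
      by (intro representable_linear S orbit_maps_compose[OF T f g])
    show "(\<lambda>\<phi>. dmap (representable G S) U V g n (dmap (representable G S) T U f n \<phi>))
        \<in> linear_maps (dob (representable G S) T n) (dob (representable G S) V n)"
      by (rule linear_maps_comp[OF representable_linear[OF S f] representable_linear[OF S g]])
    fix a assume a: "a \<in> orbit_maps G S T"
    show "dmap (representable G S) T V (compose T g f) n (delta a) =
        dmap (representable G S) U V g n (dmap (representable G S) T U f n (delta a))"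
      by (simp add: representable_delta[OF S T a] representable_delta[OF S U orbit_maps_compose[OF S a f]]
          compose_assoc[OF orbit_maps_Pi[OF a]])
  qed
qed

lemma yoneda_map_delta:
  assumes M: "vec_functor G M" and S: "S \<in> orbits G" and T: "T \<in> orbits G"
    and y: "y n \<in> carrier (dob M S n)" and a: "a \<in> orbit_maps G S T"
  shows "yoneda_map G S M y T n (delta a) = dmap M S T a n (y n)"
  unfolding yoneda_map_def using y
  by (intro lin_ext_delta vec_functor_module[OF M T] finite_orbit_maps[OF finite_G S T] a
      linear_maps_closed[OF vec_functor_linear[OF M S T]])

lemma yoneda_map_vec_map:
  assumes M: "vec_functor G M" and S: "S \<in> orbits G" and y: "\<And>n. y n \<in> carrier (dob M S n)"
  shows "yoneda_map G S M y \<in> vec_maps G (representable G S) M"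
proof -
  have lin: "yoneda_map G S M y T n \<in> linear_maps (dob (representable G S) T n) (dob M T n)"
    if T: "T \<in> orbits G" for T n
    unfolding yoneda_map_def representable_def diagram.simps using y
    by (intro lin_ext_linear vec_functor_module[OF M T] finite_orbit_maps[OF finite_G S T]
        linear_maps_closed[OF vec_functor_linear[OF M S T]])
  have "yoneda_map G S M y U n (dmap (representable G S) T U f n \<phi>) =
      dmap M T U f n (yoneda_map G S M y T n \<phi>)"
    if T: "T \<in> orbits G" and U: "U \<in> orbits G" and f: "f \<in> orbit_maps G T U"
      and \<phi>: "\<phi> \<in> carrier (dob (representable G S) T n)" for T U f n \<phi>
  proof (rule representable_eqI[OF S T vec_functor_module[OF M U] _ _ _ \<phi>])
    show "(\<lambda>\<phi>. yoneda_map G S M y U n (dmap (representable G S) T U f n \<phi>))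
        \<in> linear_maps (dob (representable G S) T n) (dob M U n)"
      by (rule linear_maps_comp[OF representable_linear[OF S f] lin[OF U]])
    show "(\<lambda>\<phi>. dmap M T U f n (yoneda_map G S M y T n \<phi>))
        \<in> linear_maps (dob (representable G S) T n) (dob M U n)"
      by (rule linear_maps_comp[OF lin[OF T] vec_functor_linear[OF M T U f]])
    fix a assume a: "a \<in> orbit_maps G S T"
    show "yoneda_map G S M y U n (dmap (representable G S) T U f n (delta a)) =
        dmap M T U f n (yoneda_map G S M y T n (delta a))"
      by (simp add: representable_delta[OF S T a] yoneda_map_delta[where y = y, OF M S T y a]
          yoneda_map_delta[where y = y, OF M S U y orbit_maps_compose[OF S a f]]
          vec_functor.map_comp[OF M S T U a f y])
  qed
  then show ?thesis
    using lin by (auto simp: vec_maps_def graded_maps_iff)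
qed

lemma precompose_delta:
  assumes "S' \<in> orbits G" "T \<in> orbits G" "a \<in> orbit_maps G S' T"
  shows "precompose G S S' f T n (delta a) = delta (compose S a f)"
  using assms by (simp add: precompose_def pushforward_delta finite_orbit_maps[OF finite_G])

lemma precompose_vec_map:
  assumes S: "S \<in> orbits G" and S': "S' \<in> orbits G" and p: "p \<in> orbit_maps G S S'"
  shows "precompose G S S' p \<in> vec_maps G (representable G S') (representable G S)"
proof -
  have lin: "precompose G S S' p T n
      \<in> linear_maps (dob (representable G S') T n) (dob (representable G S) T n)" for T n
    using orbit_maps_compose[OF S p]
    by (auto simp: precompose_def representable_def intro!: pushforward_linear)
  have "precompose G S S' p U n (dmap (representable G S') T U f n \<phi>) =
      dmap (representable G S) T U f n (precompose G S S' p T n \<phi>)"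
    if T: "T \<in> orbits G" and U: "U \<in> orbits G" and f: "f \<in> orbit_maps G T U"
      and \<phi>: "\<phi> \<in> carrier (dob (representable G S') T n)" for T U f n \<phi>
  proof (rule representable_eqI[OF S' T module_representable _ _ _ \<phi>])
    show "(\<lambda>\<phi>. precompose G S S' p U n (dmap (representable G S') T U f n \<phi>))
        \<in> linear_maps (dob (representable G S') T n) (dob (representable G S) U n)"
      by (rule linear_maps_comp[OF representable_linear[OF S' f] lin])
    show "(\<lambda>\<phi>. dmap (representable G S) T U f n (precompose G S S' p T n \<phi>))
        \<in> linear_maps (dob (representable G S') T n) (dob (representable G S) U n)"
      by (rule linear_maps_comp[OF lin representable_linear[OF S f]])
    fix a assume a: "a \<in> orbit_maps G S' T"
    show "precompose G S S' p U n (dmap (representable G S') T U f n (delta a)) =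
        dmap (representable G S) T U f n (precompose G S S' p T n (delta a))"
      by (simp add: representable_delta[OF S' T a] precompose_delta[OF S' T a]
          precompose_delta[OF S' U orbit_maps_compose[OF S' a f]]
          representable_delta[OF S T orbit_maps_compose[OF S p a]]
          compose_assoc[OF orbit_maps_Pi[OF p]])
  qed
  then show ?thesis
    using lin by (auto simp: vec_maps_def graded_maps_iff)
qed

text \<open>
  A surjection can be cancelled on the right, so precomposition with it maps basis vectors to
  distinct basis vectors.
\<close>
lemma precompose_inj:
  assumes S': "S' \<in> orbits G" and surj: "p ` S = S'"
  shows "vec_inj_map G (representable G S') (precompose G S S' p)"
proof -
  have "inj_on (\<lambda>a. compose S a p) (orbit_maps G S' T)" for T
  proof (rule inj_onI)
    fix a b assume a: "a \<in> orbit_maps G S' T" and b: "b \<in> orbit_maps G S' T"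
      and eq: "compose S a p = compose S b p"
    show "a = b"
    proof (rule extensionalityI[OF orbit_maps_extensional[OF a] orbit_maps_extensional[OF b]])
      fix x assume "x \<in> S'"
      then obtain s where "s \<in> S" "x = p s" using surj by auto
      then show "a x = b x" using fun_cong[OF eq, of s] by (simp add: compose_eq)
    qed
  qed
  then show ?thesis
    using finite_orbit_maps[OF finite_G S']
    by (auto simp: vec_inj_map_def precompose_def representable_def intro!: inj_on_pushforward)
qed

section \<open>Injective diagrams send surjections of orbits to surjections\<close>

text \<open>
  An element \<open>z\<close> over \<open>S'\<close> is a map out of \<open>\<rat>[Hom(S', -)]\<close>, a subdiagram of \<open>\<rat>[Hom(S, -)]\<close> by
  precomposition with \<open>p\<close>. Extending the map to the larger diagram and evaluating it at the
  identity of \<open>S\<close> gives a preimage of \<open>z\<close>.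
\<close>
theorem vec_injective_surj:
  fixes M :: "('a, 'u) vec_diagram"
  assumes M: "vec_injective G M" and univ: "infinite (UNIV :: 'u set)"
    and S: "S \<in> orbits G" and S': "S' \<in> orbits G" and p: "p \<in> orbit_maps G S S'"
    and surj: "p ` S = S'"
  shows "dmap M S S' p n ` carrier (dob M S n) = carrier (dob M S' n)"
proof
  have F: "vec_functor G M" using M by (simp add: vec_injective_def)
  show "dmap M S S' p n ` carrier (dob M S n) \<subseteq> carrier (dob M S' n)"
    using linear_maps_closed[OF vec_functor_linear[OF F S S' p]] by blast
  show "carrier (dob M S' n) \<subseteq> dmap M S S' p n ` carrier (dob M S n)"
  proof
    fix z assume z: "z \<in> carrier (dob M S' n)"
    \<comment> \<open>A map of diagrams has components in all degrees: take it to be zero away from \<open>n\<close>.\<close>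
    define y where "y m = (if m = n then z else \<zero>\<^bsub>dob M S' m\<^esub>)" for m
    have y: "y m \<in> carrier (dob M S' m)" for m
      using z abelian_groupE(2)[OF module.axioms(2)[OF vec_functor_module[OF F S']]]
      by (simp add: y_def)
    have embed: "\<exists>e :: (('a set \<Rightarrow> 'a set) \<Rightarrow> rat) \<Rightarrow> 'u. inj_on e (carrier (dob (representable G U) T m))"
      if "U \<in> orbits G" "T \<in> orbits G" for U T m
    proof -
      have "countable (carrier (dob (representable G U) T m))"
        using that by (simp add: representable_def countable_free_space finite_orbit_maps[OF finite_G])
      moreover obtain k :: "nat \<Rightarrow> 'u" where "inj k"
        using infinite_countable_subset[OF univ] by blast
      ultimately show ?thesis
        by (meson comp_inj_on inj_on_subset inj_on_to_nat_on subset_UNIV)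
    qed
    obtain h where h: "h \<in> vec_maps G (representable G S) M"
      and extends: "\<And>T m \<phi>. T \<in> orbits G \<Longrightarrow> \<phi> \<in> carrier (dob (representable G S') T m)
        \<Longrightarrow> h T m (precompose G S S' p T m \<phi>) = yoneda_map G S' M y T m \<phi>"
      using vec_injective_extend[OF M vec_functor_representable[OF S'] vec_functor_representable[OF S]
          precompose_vec_map[OF S S' p] precompose_inj[OF S' surj]
          yoneda_map_vec_map[where y = y, OF F S' y] embed[OF S'] embed[OF S]]
      by blast
    let ?id = "\<lambda>t \<in> S. t" and ?id' = "\<lambda>t \<in> S'. t"
    have id: "delta ?id \<in> carrier (dob (representable G S) S n)"
      and id': "delta ?id' \<in> carrier (dob (representable G S') S' n)"
      using delta_in_free_space[OF orbit_maps_id] S S' by (simp_all add: representable_def del: free_space_simps)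
    \<comment> \<open>Both \<open>id\<^sub>S\<close>, pushed along \<open>p\<close>, and \<open>id\<^sub>S\<^sub>'\<close>, pulled back along \<open>p\<close>, are \<open>p\<close> itself.\<close>
    have "compose S p ?id = p"
      by (rule compose_Id[OF orbit_maps_Pi[OF p] orbit_maps_extensional[OF p]])
    moreover have "compose S ?id' p = p"
      by (rule Id_compose[OF orbit_maps_Pi[OF p] orbit_maps_extensional[OF p]])
    ultimately have "dmap (representable G S) S S' p n (delta ?id) = precompose G S S' p S' n (delta ?id')"
      by (simp add: representable_delta[OF S S orbit_maps_id[OF S]]
          precompose_delta[OF S' S' orbit_maps_id[OF S']])
    then have "h S' n (dmap (representable G S) S S' p n (delta ?id)) = yoneda_map G S' M y S' n (delta ?id')"
      by (simp add: extends[OF S' id'])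
    also have "\<dots> = dmap M S' S' ?id' n (y n)"
      by (rule yoneda_map_delta[OF F S' S' y orbit_maps_id[OF S']])
    also have "\<dots> = z"
      using vec_functor.map_id[OF F S' y[of n]] by (simp add: y_def)
    finally have "dmap M S S' p n (h S n (delta ?id)) = z"
      using h S S' p id by (auto simp: vec_maps_def)
    then show "z \<in> dmap M S S' p n ` carrier (dob M S n)"
      using vec_maps_closed[OF h S id] by blast
  qed
qed

end

lemma orbit_proj_lcoset:
  assumes H: "subgroup H G" and K: "subgroup K G" and "H \<subseteq> K" and a: "a \<in> carrier G"
  shows "orbit_proj G H K (a <# H) = a <# K"
proof -
  have "H <#> K = K"
  proof
    show "H <#> K \<subseteq> K"
      using assms subgroup.m_closed[OF K] by (auto simp: set_mult_def)
    show "K \<subseteq> H <#> K"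
      using subgroup.one_closed[OF H] subgroup.subset[OF K] by (force simp: set_mult_def)
  qed
  moreover have "(a <# H) <#> K = a <# (H <#> K)"
    using a subgroup.subset[OF H] subgroup.subset[OF K] set_mult_assoc[of "{a}" H K]
    by (simp add: l_coset_eq_set_mult)
  ultimately show ?thesis
    using a by (auto simp: orbit_proj_def LCOSETS_def)
qed

lemma orbit_proj_surj:
  assumes "subgroup H G" "subgroup K G" "H \<subseteq> K"
  shows "orbit_proj G H K ` (lcosets H) = lcosets K"
  using orbit_proj_lcoset[OF assms] by (auto simp: LCOSETS_def image_iff)

lemma orbit_proj_orbit_map:
  assumes H: "subgroup H G" and K: "subgroup K G" and "H \<subseteq> K"
  shows "orbit_proj G H K \<in> orbit_maps G (lcosets H) (lcosets K)"
proof -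
  have "orbit_proj G H K (g <# (a <# H)) = g <# orbit_proj G H K (a <# H)"
    if "g \<in> carrier G" "a \<in> carrier G" for g a
    using that orbit_proj_lcoset[OF assms]
    by (simp add: lcos_m_assoc subgroup.subset[OF H] subgroup.subset[OF K])
  moreover have "orbit_proj G H K \<in> extensional (lcosets H)"
    by (simp add: orbit_proj_def)
  ultimately show ?thesis
    using orbit_proj_lcoset[OF assms] by (auto simp: orbit_maps_def PiE_def LCOSETS_def)
qed

end

text \<open>
  The rational multiples of the unit have distinct classes in \<open>H\<^sup>0\<close>, so they are distinct.
\<close>
lemma coh_1_connected_infinite:
  fixes A :: "'u dga"
  assumes "coh_1_connected A"
  shows "infinite (UNIV :: 'u set)"
proof -
  have "inj (\<lambda>c :: rat. coh_class A 0 (c \<odot>\<^bsub>dga_comp A 0\<^esub> dga_unit A))"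
    using assms by (simp add: coh_1_connected_def bij_betw_def)
  then have "inj (\<lambda>c :: rat. c \<odot>\<^bsub>dga_comp A 0\<^esub> dga_unit A)"
    by (auto simp: inj_def)
  then show ?thesis
    using infinite_UNIV_char_0[where 'a = rat] finite_imageD finite_subset subset_UNIV by metis
qed

theorem proposition3p3:
  fixes G :: "('g, 'm) monoid_scheme" and p q :: nat and A :: "('g, 'u) dga_diagram"
  assumes "prime p" and "prime q" and "p \<noteq> q"
    and "group G" and "cyclic_group G" and "Coset.order G = p * q"
    and "dga_functor G A"
    and "vec_injective G (forget A)"
  shows "\<forall>H K. subgroup H G \<and> subgroup K G \<and> H \<subseteq> K \<longrightarrow>
    (\<forall>n. structure_map G A H K n ` carrier (dga_comp (dob A (lcosets\<^bsub>G\<^esub> H)) n) =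
         carrier (dga_comp (dob A (lcosets\<^bsub>G\<^esub> K)) n))"
proof (intro allI impI, elim conjE)
  fix H K n assume H: "subgroup H G" and K: "subgroup K G" and "H \<subseteq> K"
  interpret group G by fact
  have "p * q > 0" using assms(1,2) by (simp add: prime_gt_0_nat)
  then have fin: "finite (carrier G)"
    using assms(6) by (metis order_gt_0_iff_finite)
  have HK: "lcosets\<^bsub>G\<^esub> H \<in> orbits G" "lcosets\<^bsub>G\<^esub> K \<in> orbits G"
    using H K by (auto simp: orbits_def)
  have "infinite (UNIV :: 'u set)"
    using coh_1_connected_infinite dga_functor.ob_connected[OF assms(7) HK(1)] by blast
  from vec_injective_surj[OF fin assms(8) this HK orbit_proj_orbit_map[OF H K \<open>H \<subseteq> K\<close>]
      orbit_proj_surj[OF H K \<open>H \<subseteq> K\<close>], of n]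
  show "structure_map G A H K n ` carrier (dga_comp (dob A (lcosets\<^bsub>G\<^esub> H)) n) =
      carrier (dga_comp (dob A (lcosets\<^bsub>G\<^esub> K)) n)"
    by (simp add: structure_map_def forget_def)
qed

end
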